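(* The $\theta_5$-graph has spanning ratio at least $\frac{1}{2}(11\sqrt{5}-17) \approx 3.798$. That is, the supremum, over all finite planar point sets $P$ (in general position with respect to the cone directions), of the spanning ratio of the $\theta_5$-graph of $P$ is at least $\frac{1}{2}(11\sqrt{5}-17)$: for every $\varepsilon>0$ there exist a finite point set $P$ and distinct points $u,w\in P$ such that every path between $u$ and $w$ in the $\theta_5$-graph of $P$ has Euclidean length greater than $\left(\frac{1}{2}(11\sqrt{5}-17)-\varepsilon\right)\cdot|uw|$.
   Context: Let $\theta = 2\pi/5$. For a point $u$ in the plane, the five rays from $u$ whose directions make angles that are consecutive multiples of $\theta$ with the negative $y$-axis divide the plane into five cones with apex $u$, labelled $C_0^u, C_1^u, C_2^u, C_3^u, C_4^u$ in clockwise order starting from the top one; thus the bisector of $C_i^u$ is the ray from $u$ whose direction is the positive $y$-direction rotated clockwise by $i\theta$. General position: no two distinct points of $P$ lie on a line parallel or perpendicular to a cone boundary. (Hence each point of $P\setminus\{u\}$ lies in the interior of exactly one cone of $u$, and no two points of $P$ in a cone have the same projection on its bisector.) For a finite point set $P$, the point of $P\setminus\{u\}$ in cone $C_i^u$ that is closest to $u$ is the one whose orthogonal projection onto the bisector of $C_i^u$ is closest to $u$. The $\theta_5$-graph of $P$ is the undirected graph with vertex set $P$ in which, for every $u\in P$ and every $i\in\{0,\dots,4\}$ such that $C_i^u$ contains a point of $P\setminus\{u\}$, there is an edge between $u$ and the closest point to $u$ in $C_i^u$. The weight (length) of an edge is the Euclidean distance between its endpoints; $|uw|$ denotes Euclidean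 distance; the length of a path is the sum of the lengths of its edges. The spanning ratio of a graph $H$ on $P$ is the smallest $t$ such that for all pairs $u,w\in P$ the shortest path in $H$ between $u$ and $w$ has length at most $t\cdot|uw|$. *)

theory Defs
  imports "HOL-Analysis.Analysis"
begin

text \<open>The plane is the type \<^typ>\<open>complex\<close>: \<open>dist\<close> is the Euclidean distance, \<open>\<bullet>\<close> the usual
  inner product, and multiplication by \<open>cis \<phi>\<close> is the counterclockwise rotation by \<open>\<phi>\<close>.\<close>

definition cone_angle :: real where
  "cone_angle = 2 * pi / 5"

text \<open>Directions of the boundary rays, by counterclockwise angle from the negative y-axis;
  \<open>boundary_dir\<close> has period 5 in its argument.\<close>

definition boundary_dir :: "int \<Rightarrow> complex" where
  "boundary_dir k = - \<i> * cis (of_int k * cone_angle)"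

definition bisector_dir :: "nat \<Rightarrow> complex" where
  "bisector_dir i = \<i> * cis (- (real i * cone_angle))"

text \<open>The top cone (\<open>i = 0\<close>) lies between the boundary rays with indices 2 and 3, and increasing
  \<open>i\<close> by one is a clockwise rotation. Cones are closed; in general position no point of the set
  lies on a boundary of a cone of another point, so the boundary convention is immaterial.\<close>

definition theta_cone :: "nat \<Rightarrow> complex \<Rightarrow> complex set" where
  "theta_cone i u =
    {u + a *\<^sub>R boundary_dir (2 - int i) + b *\<^sub>R boundary_dir (3 - int i) | a b. a \<ge> 0 \<and> b \<ge> 0}"

lemma boundary_dir_bisector_dir:
  "boundary_dir (2 - int i) = bisector_dir i * cis (- (cone_angle / 2))"
  "boundary_dir (3 - int i) = bisector_dir i * cis (cone_angle / 2)"
proof -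
  have "- \<i> = \<i> * cis (- pi)" by (simp add: complex_eq_iff)
  then have *: "- \<i> * cis t = \<i> * cis (t - pi)" for t
    by (simp only: mult.assoc cis_mult) simp
  have "of_int (2 - int i) * cone_angle - pi = - (real i * cone_angle) + - (cone_angle / 2)"
       "of_int (3 - int i) * cone_angle - pi = - (real i * cone_angle) + cone_angle / 2"
    by (simp_all add: cone_angle_def field_simps)
  then show "boundary_dir (2 - int i) = bisector_dir i * cis (- (cone_angle / 2))"
       "boundary_dir (3 - int i) = bisector_dir i * cis (cone_angle / 2)"
    unfolding boundary_dir_def bisector_dir_def * mult.assoc cis_mult by simp_all
qed

definition general_position :: "complex set \<Rightarrow> bool" where
  "general_position P \<longleftrightarrow>
    (\<forall>p\<in>P. \<forall>q\<in>P. p \<noteq> q \<longrightarrow>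
      (\<forall>k. q - p \<notin> span {boundary_dir k} \<and> \<not> orthogonal (q - p) (boundary_dir k)))"

text \<open>Orthogonal projection of \<open>v\<close> onto the line through \<open>u\<close> along the bisector of cone \<open>i\<close> of \<open>u\<close>;
  for \<open>v\<close> in that cone it lies on the bisector ray. Note that \<open>bisector_dir i\<close> is a unit vector.\<close>

definition bisector_proj :: "nat \<Rightarrow> complex \<Rightarrow> complex \<Rightarrow> complex" where
  "bisector_proj i u v = u + ((v - u) \<bullet> bisector_dir i) *\<^sub>R bisector_dir i"

definition closest_in_cone :: "complex set \<Rightarrow> nat \<Rightarrow> complex \<Rightarrow> complex \<Rightarrow> bool" where
  "closest_in_cone P i u w \<longleftrightarrow>
    is_arg_min (\<lambda>v. dist u (bisector_proj i u v)) (\<lambda>v. v \<in> (P - {u}) \<inter> theta_cone i u) w"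

text \<open>Undirected graphs on a vertex set \<open>P\<close> are given by their edge sets, whose elements are
  unordered pairs \<open>{u, w}\<close>.\<close>

definition theta5_edges :: "complex set \<Rightarrow> complex set set" where
  "theta5_edges P = {{u, w} | u w. u \<in> P \<and> (\<exists>i<5. closest_in_cone P i u w)}"

definition is_path :: "complex set \<Rightarrow> complex set set \<Rightarrow> complex \<Rightarrow> complex \<Rightarrow> complex list \<Rightarrow> bool"
  where
  "is_path P E u w xs \<longleftrightarrow>
    xs \<noteq> [] \<and> hd xs = u \<and> last xs = w \<and> set xs \<subseteq> P \<and> distinct xs \<and>
    successively (\<lambda>x y. {x, y} \<in> E) xs"

definition path_length :: "complex list \<Rightarrow> real" where
  "path_length xs = (\<Sum>(x, y)\<leftarrow>zip xs (tl xs). dist x y)"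

text \<open>The value is \<open>\<infinity>\<close> if there is no path.\<close>

definition graph_dist :: "complex set \<Rightarrow> complex set set \<Rightarrow> complex \<Rightarrow> complex \<Rightarrow> ennreal" where
  "graph_dist P E u w = (INF xs\<in>{xs. is_path P E u w xs}. ennreal (path_length xs))"

definition spanning_ratio :: "complex set \<Rightarrow> complex set set \<Rightarrow> ennreal" where
  "spanning_ratio P E =
    Inf {t. \<forall>u\<in>P. \<forall>w\<in>P. graph_dist P E u w \<le> t * ennreal (dist u w)}"

end

theory Submission
  imports Defs
begin

text \<open>A path is at least as long as the difference of any potential at its ends, provided that every
  edge changes the potential by at most the length of the edge. In the configuration below the
  vertices 1, 2, 3, 4, 5, 0 form a path of total length \<open>100 * (11 * sqrt 5 - 17)\<close> between two points
  at distance 200: vertex 1 is the right corner of the triangle in the top cone of vertex 0, each of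
  2, 3, 4 is a corner, furthest from 0, of the triangle that its predecessor spans with vertex 0, and 5 is
  the point of the top boundary of a cone of 4 that has 0 on one of its own cone boundaries. On
  it the potential is the distance to 0 along the path.

  The other 20 vertices, found by computer search, block the shortcuts: if the potential
  difference of two vertices exceeds their distance, then neither is closest to the other, because
  each has another vertex nearer in the same cone. The six vertices of the path are in degenerate
  position (on cone boundaries, or with equal projections on a bisector), so the vertices are moved
  by \<open>\<delta>\<close> times a shift that resolves these ties, and by a term of order \<open>\<delta>\<^sup>2\<close> that makes
  the position general. Letting \<open>\<delta>\<close> tend to 0 gives the bound, and all conditions on the
  configuration are sign conditions in \<open>\<int>[\<surd>5]\<close>.\<close>

section \<open>Cones\<close>

text \<open>As five times the angle is a full turn, its double and its triple have the same cosine.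
  This is a cubic equation for the cosine, and positivity and \<open>c \<noteq> 1\<close> single out
  one root.\<close>

lemma cos_cone_angle: "cos cone_angle = (sqrt 5 - 1) / 4"
proof -
  define c where "c = cos cone_angle"
  have "cos (3 * cone_angle) = cos (2 * pi - 2 * cone_angle)"
    by (rule arg_cong[where f = cos]) (simp add: cone_angle_def)
  also have "\<dots> = cos (2 * cone_angle)"
    by (simp add: cos_diff)
  finally have "4 * c ^ 3 - 3 * c = 2 * c\<^sup>2 - 1"
    by (simp add: c_def cos_treble_cos cos_double_cos)
  then have "(c - 1) * ((4 * c + 1)\<^sup>2 - 5) = 0"
    by (simp add: algebra_simps power2_eq_square power3_eq_cube)
  moreover have "c > 0"
    unfolding c_def by (rule cos_gt_zero) (auto simp: cone_angle_def)
  moreover have "c \<noteq> 1"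
    using cos_monotone_0_pi[of 0 cone_angle] by (simp add: c_def cone_angle_def)
  ultimately have "4 * c + 1 = sqrt 5"
    by (intro real_sqrt_unique[symmetric]) auto
  then show ?thesis
    by (simp add: c_def)
qed

lemma sin_cone_angle_pos: "0 < sin cone_angle"
  by (rule sin_gt_zero) (auto simp: cone_angle_def)

lemma sin_cone_angle_nonzero [simp]: "sin cone_angle \<noteq> 0"
  using sin_cone_angle_pos by simp

lemma sin_cone_angle_sq: "(sin cone_angle)\<^sup>2 = (5 + sqrt 5) / 8"
proof -
  have "(sin cone_angle)\<^sup>2 = 1 - (cos cone_angle)\<^sup>2"
    by (simp add: sin_squared_eq)
  also have "\<dots> = (5 + sqrt 5) / 8"
    by (simp add: cos_cone_angle power2_eq_square field_simps)
  finally show ?thesis .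
qed

text \<open>The angles between a boundary ray and the bisectors are odd multiples of
  \<open>pi / 5\<close>, of which \<open>pi / 5\<close> itself has the largest cosine. Differences
  of two cone indices lie between -4 and 4.\<close>

lemma cos_odd_multiple_le:
  fixes m :: int
  assumes "\<bar>m\<bar> \<le> 4"
  shows "cos (of_int m * cone_angle + cone_angle / 2) \<le> cos (cone_angle / 2)"
proof -
  have le: "cos (of_nat n * (pi / 5)) \<le> cos (pi / 5)" if "n \<in> {1, 3, 5, 7, 9}" for n :: nat
  proof -
    have 7: "cos (7 * (pi / 5)) = cos (3 * (pi / 5))"
      using cos_2pi_minus[of "3 * (pi / 5)"] by (simp add: field_simps)
    have 9: "cos (9 * (pi / 5)) = cos (pi / 5)"
      using cos_2pi_minus[of "pi / 5"] by (simp add: field_simps)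
    have "cos (3 * (pi / 5)) \<le> cos (pi / 5)"
      by (rule cos_monotone_0_pi_le) auto
    with that show ?thesis
      by (auto simp del: times_divide_eq_right simp: 7 9)
        (use cos_ge_minus_one[of "pi / 5"] in simp)
  qed
  have "of_int m * cone_angle + cone_angle / 2 = of_int (2 * m + 1) * (pi / 5)"
    by (simp add: cone_angle_def field_simps)
  moreover have "cos (of_int (2 * m + 1) * (pi / 5)) = cos (of_nat (nat \<bar>2 * m + 1\<bar>) * (pi / 5))"
    using cos_abs_real[of "of_int (2 * m + 1) * (pi / 5)"] by (simp add: abs_mult)
  moreover have "nat \<bar>2 * m + 1\<bar> \<in> {1, 3, 5, 7, 9}"
  proof -
    have "m = - 4 \<or> m = - 3 \<or> m = - 2 \<or> m = - 1 \<or> m = 0 \<or> m = 1 \<or> m = 2 \<or> m = 3 \<or> m = 4"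
      using assms by arith
    then show ?thesis by auto
  qed
  moreover have "cone_angle / 2 = pi / 5"
    by (simp add: cone_angle_def)
  ultimately show ?thesis
    using le by metis
qed

lemma inner_cis: "(z * cis s) \<bullet> (z * cis t) = (norm z)\<^sup>2 * cos (s - t)"
  unfolding cmod_power2 cos_diff by (simp add: inner_complex_def power2_eq_square algebra_simps)

lemma norm_bisector_dir [simp]: "norm (bisector_dir c) = 1"
  by (simp add: bisector_dir_def norm_mult)

lemma bisector_dir_rotate: "bisector_dir k = bisector_dir c * cis (of_int (int c - int k) * cone_angle)"
  by (simp add: bisector_dir_def mult.assoc cis_mult algebra_simps)

lemma bisector_dir_mod_5: "bisector_dir (k mod 5) = bisector_dir k"
proof -
  have "real k = 5 * real (k div 5) + real (k mod 5)"
    by (metis mult_div_mod_eq of_nat_add of_nat_mult of_nat_numeral)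
  then have "- (real (k mod 5) * cone_angle) = - (real k * cone_angle) + 2 * pi * real (k div 5)"
    unfolding cone_angle_def by algebra
  moreover have "cis (2 * pi * real (k div 5)) = 1"
    by (simp add: complex_eq_iff)
  ultimately show ?thesis
    by (simp only: bisector_dir_def cis_mult[symmetric] mult_1_right)
qed

text \<open>Each of the two boundary rays of a cone has its largest inner product with the bisector
  of that cone, and this carries over to nonnegative combinations. With \<open>theta_coneI\<close>,
  membership in a cone becomes a comparison of inner products.\<close>

lemma theta_coneD:
  assumes "v \<in> theta_cone c u" "c < 5" "k < 5"
  shows "(v - u) \<bullet> bisector_dir k \<le> (v - u) \<bullet> bisector_dir c" "0 \<le> (v - u) \<bullet> bisector_dir c"
proof -
  let ?h = "cone_angle / 2" and ?m = "int c - int k"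
  obtain a b where a: "a \<ge> 0" and b: "b \<ge> 0"
    and v: "v - u = a *\<^sub>R (bisector_dir c * cis (- ?h)) + b *\<^sub>R (bisector_dir c * cis ?h)"
    using assms by (auto simp: theta_cone_def boundary_dir_bisector_dir)
  have *: "(v - u) \<bullet> (bisector_dir c * cis t) = a * cos (t + ?h) + b * cos (?h - t)" for t
    unfolding v inner_add_left inner_scaleR_left inner_cis
    by (simp add: cos_add cos_diff)
  have c: "(v - u) \<bullet> bisector_dir c = a * cos ?h + b * cos ?h"
    using *[of 0] by simp
  have "cos (of_int ?m * cone_angle + ?h) \<le> cos ?h"
    "cos (?h - of_int ?m * cone_angle) \<le> cos ?h"
    using cos_odd_multiple_le[of ?m] cos_odd_multiple_le[of "- ?m"] assms(2,3) by (auto simp: algebra_simps)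
  then show "(v - u) \<bullet> bisector_dir k \<le> (v - u) \<bullet> bisector_dir c"
    unfolding c bisector_dir_rotate[of k c] * using a b by (intro add_mono mult_left_mono)
  have "0 \<le> cos ?h"
    by (intro less_imp_le cos_gt_zero) (auto simp: cone_angle_def)
  then show "0 \<le> (v - u) \<bullet> bisector_dir c"
    using a b by (simp add: c)
qed

text \<open>Only the two neighbouring bisectors matter. In the orthonormal frame of the bisector
  their inequalities say, by half-angle formulas, that the direction deviates from it by at most
  half the cone angle.\<close>

lemma theta_coneI:
  assumes "\<And>k. k < 5 \<Longrightarrow> (v - u) \<bullet> bisector_dir k \<le> (v - u) \<bullet> bisector_dir c"
  shows "v \<in> theta_cone c u"
proof -
  let ?h = "cone_angle / 2" and ?z = "bisector_dir c"
  define x where "x = (v - u) \<bullet> ?z"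
  define y where "y = (v - u) \<bullet> (?z * \<i>)"
  have z: "(Re ?z)\<^sup>2 + (Im ?z)\<^sup>2 = 1"
    using norm_bisector_dir[of c] by (simp add: cmod_def)
  have vu: "v - u = ?z * Complex x y"
    using z by (simp add: complex_eq_iff x_def y_def inner_complex_def) algebra
  have inner: "(v - u) \<bullet> (?z * cis t) = x * cos t + y * sin t" for t
    unfolding x_def y_def by (simp add: inner_complex_def algebra_simps)
  have h: "0 < sin ?h" "0 < cos ?h"
    by (auto simp: cone_angle_def intro!: sin_gt_zero cos_gt_zero)
  have "bisector_dir ((c + 1) mod 5) = ?z * cis (- cone_angle)"
    unfolding bisector_dir_mod_5 by (subst bisector_dir_rotate[of _ c]) simp
  moreover have "bisector_dir ((c + 4) mod 5) = ?z * cis cone_angle"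
  proof -
    have "cis (- (4 * cone_angle)) = cis cone_angle"
      using sin_periodic[of "- (4 * cone_angle)"] cos_periodic[of "- (4 * cone_angle)"]
      by (simp add: complex_eq_iff cone_angle_def)
    then show ?thesis
      unfolding bisector_dir_mod_5 by (subst bisector_dir_rotate[of _ c]) simp
  qed
  ultimately have "x * cos cone_angle - y * sin cone_angle \<le> x" "x * cos cone_angle + y * sin cone_angle \<le> x"
    using assms[of "(c + 1) mod 5"] assms[of "(c + 4) mod 5"] inner[of "- cone_angle"] inner[of cone_angle]
    by (simp_all add: x_def)
  moreover have "cos cone_angle = 1 - 2 * sin ?h * sin ?h" "sin cone_angle = 2 * sin ?h * cos ?h"
    using cos_double_sin[of ?h] sin_double[of ?h] by (simp_all add: power2_eq_square)
  ultimately have "2 * sin ?h * (- (y * cos ?h)) \<le> 2 * sin ?h * (x * sin ?h)"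
    "2 * sin ?h * (y * cos ?h) \<le> 2 * sin ?h * (x * sin ?h)"
    by (simp_all add: algebra_simps)
  then have xy: "- (y * cos ?h) \<le> x * sin ?h" "y * cos ?h \<le> x * sin ?h"
    using h by (simp_all only: mult_le_cancel_left_pos mult_pos_pos zero_less_numeral)
  \<comment> \<open>\<open>a\<close> and \<open>b\<close> solve the linear system
    \<open>Complex x y = a *\<^sub>R cis (- ?h) + b *\<^sub>R cis ?h\<close>.\<close>
  define a where "a = (x * sin ?h - y * cos ?h) / (2 * sin ?h * cos ?h)"
  define b where "b = (x * sin ?h + y * cos ?h) / (2 * sin ?h * cos ?h)"
  have "a \<ge> 0" "b \<ge> 0"
    using h xy by (auto simp: a_def b_def)
  moreover have "v = u + a *\<^sub>R boundary_dir (2 - int c) + b *\<^sub>R boundary_dir (3 - int c)"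
  proof -
    have "Complex x y = a *\<^sub>R cis (- ?h) + b *\<^sub>R cis ?h"
      using h by (simp add: complex_eq_iff a_def b_def field_simps)
    then have "v - u = a *\<^sub>R (?z * cis (- ?h)) + b *\<^sub>R (?z * cis ?h)"
      unfolding vu by (simp add: distrib_left)
    then show ?thesis
      by (simp add: boundary_dir_bisector_dir algebra_simps)
  qed
  ultimately show ?thesis
    unfolding theta_cone_def by blast
qed

lemma dist_bisector_proj: "dist u (bisector_proj i u v) = \<bar>(v - u) \<bullet> bisector_dir i\<bar>"
  by (simp add: bisector_proj_def dist_norm)

text \<open>Strict inequalities make \<open>c\<close> the only cone of \<open>u\<close> that
  contains \<open>w\<close>, and there \<open>z\<close> has the smaller projection.\<close>

lemma not_closest_in_cone:
  assumes "c < 5" and w: "\<And>k. k < 5 \<Longrightarrow> k \<noteq> c \<Longrightarrow> (w - u) \<bullet> bisector_dir k < (w - u) \<bullet> bisector_dir c"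
    and z: "z \<in> P" "\<And>k. k < 5 \<Longrightarrow> k \<noteq> c \<Longrightarrow> (z - u) \<bullet> bisector_dir k < (z - u) \<bullet> bisector_dir c"
    and less: "(z - u) \<bullet> bisector_dir c < (w - u) \<bullet> bisector_dir c"
    and "i < 5"
  shows "\<not> closest_in_cone P i u w"
proof
  assume *: "closest_in_cone P i u w"
  then have wi: "w \<in> theta_cone i u"
    by (auto simp: closest_in_cone_def is_arg_min_def)
  have "i = c"
    using theta_coneD(1)[OF wi \<open>i < 5\<close> \<open>c < 5\<close>] w[of i] \<open>i < 5\<close> by fastforce
  \<comment> \<open>Some index other than \<open>c\<close> is needed: at \<open>z = u\<close> both
    sides of the strict inequality would be 0.\<close>
  obtain k :: nat where "k < 5" "k \<noteq> c"
    using that[of 0] that[of 1] by (cases "c = 0") auto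
  then have "z \<noteq> u"
    using z(2) by fastforce
  moreover have zc: "z \<in> theta_cone c u"
    using z(2) by (intro theta_coneI) (metis less_eq_real_def)
  ultimately have "\<not> dist u (bisector_proj c u z) < dist u (bisector_proj c u w)"
    using * z(1) \<open>i = c\<close> by (auto simp: closest_in_cone_def is_arg_min_def)
  moreover have "0 \<le> (z - u) \<bullet> bisector_dir c" 
    using theta_coneD(2)[OF zc \<open>c < 5\<close>] \<open>c < 5\<close> by blast
  ultimately show False
    using less by (simp add: dist_bisector_proj)
qed

section \<open>General position\<close>

lemma boundary_dir_mod_5: "boundary_dir (k mod 5) = boundary_dir k"
proof -
  have "real_of_int k = 5 * of_int (k div 5) + of_int (k mod 5)"
    by (metis mult_div_mod_eq of_int_add of_int_mult of_int_numeral)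
  then have "of_int (k mod 5) * cone_angle = of_int k * cone_angle + 2 * pi * - of_int (k div 5)"
    unfolding cone_angle_def by algebra
  moreover have "cis (2 * pi * - of_int (k div 5)) = 1"
    using cis_multiple_2pi[of "- of_int (k div 5)"] by simp
  ultimately show ?thesis
    by (simp only: boundary_dir_def cis_mult[symmetric] mult_1_right)
qed

text \<open>The direction \<open>1 + \<i>\<close> is neither parallel nor perpendicular to a cone boundary.\<close>

lemma inner_boundary_dir_diagonal:
  "(1 + \<i>) \<bullet> boundary_dir k \<noteq> 0" "(1 + \<i>) \<bullet> (\<i> * boundary_dir k) \<noteq> 0"
proof -
  define t where "t = of_int k * cone_angle"
  \<comment> \<open>Up to sign, \<open>cos (2 * t)\<close> is the product of the two inner products,
    so a single parity argument covers both.\<close>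
  have "cos (2 * t) \<noteq> 0"
  proof
    assume "cos (2 * t) = 0"
    then obtain m :: int where m: "odd m" "2 * t = of_int m * (pi / 2)"
      by (auto simp: cos_zero_iff_int)
    then have "of_int (8 * k) * pi = of_int (5 * m) * pi"
      by (simp add: t_def cone_angle_def field_simps)
    then have "8 * k = 5 * m"
      by (metis mult_cancel_right of_int_eq_iff pi_neq_zero)
    with m(1) show False
      by presburger
  qed
  then have "(sin t - cos t) * (sin t + cos t) \<noteq> 0"
    unfolding cos_double by algebra
  moreover have "(1 + \<i>) \<bullet> boundary_dir k = sin t - cos t" "(1 + \<i>) \<bullet> (\<i> * boundary_dir k) = cos t + sin t"
    by (simp_all add: boundary_dir_def inner_complex_def t_def)
  ultimately show "(1 + \<i>) \<bullet> boundary_dir k \<noteq> 0" "(1 + \<i>) \<bullet> (\<i> * boundary_dir k) \<noteq> 0"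
    by auto
qed

text \<open>Being parallel to a direction is being orthogonal to its quarter turn. Both conditions
  thus become nonvanishing of linear functionals, which suits perturbation, and periodicity leaves
  five directions.\<close>

lemma general_positionI:
  assumes "\<And>p q k. p \<in> P \<Longrightarrow> q \<in> P \<Longrightarrow> p \<noteq> q \<Longrightarrow> k \<in> {0..<5} \<Longrightarrow>
    (q - p) \<bullet> boundary_dir k \<noteq> 0 \<and> (q - p) \<bullet> (\<i> * boundary_dir k) \<noteq> 0"
  shows "general_position P"
  unfolding general_position_def
proof (intro ballI impI allI)
  fix p q k
  assume "p \<in> P" "q \<in> P" "p \<noteq> q"
  then have *: "(q - p) \<bullet> boundary_dir k \<noteq> 0" "(q - p) \<bullet> (\<i> * boundary_dir k) \<noteq> 0"
    using assms[of p q "k mod 5"] by (auto simp: boundary_dir_mod_5)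
  have "q - p \<notin> span {boundary_dir k}"
  proof
    assume "q - p \<in> span {boundary_dir k}"
    then obtain r where "q - p = r *\<^sub>R boundary_dir k"
      by (auto simp: span_singleton)
    then have "(q - p) \<bullet> (\<i> * boundary_dir k) = r * (boundary_dir k \<bullet> (\<i> * boundary_dir k))"
      by simp
    with *(2) show False
      by (simp add: inner_complex_def)
  qed
  with *(1) show "q - p \<notin> span {boundary_dir k} \<and> \<not> orthogonal (q - p) (boundary_dir k)"
    by (simp add: orthogonal_def)
qed

section \<open>Lower bounds for paths and spanning ratios\<close>

text \<open>The potential differences telescope, and each of the \<open>length xs - 1\<close> edges
  may lose \<eta>.\<close>

lemma path_length_ge:
  assumes "xs \<noteq> []" "successively (\<lambda>x y. {x, y} \<in> E) xs" "set xs \<subseteq> P"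
    and "\<And>x y. x \<in> P \<Longrightarrow> y \<in> P \<Longrightarrow> {x, y} \<in> E \<Longrightarrow> g x - g y - \<eta> \<le> dist x y"
  shows "g (hd xs) - g (last xs) - \<eta> * (real (length xs) - 1) \<le> path_length xs"
  using assms(1-3)
proof (induction xs rule: induct_list012)
  case (3 x y zs)
  have "path_length (x # y # zs) = dist x y + path_length (y # zs)"
    by (simp add: path_length_def)
  moreover have "g x - g y - \<eta> \<le> dist x y"
    using 3 assms(4) by auto
  moreover have "g y - g (last (y # zs)) - \<eta> * (real (length (y # zs)) - 1) \<le> path_length (y # zs)"
    using 3 by auto
  ultimately show ?case
    by (simp add: algebra_simps)
qed (simp_all add: path_length_def)

lemma spanning_ratio_ge:
  assumes "u \<in> P" "w \<in> P" "u \<noteq> w" "\<And>xs. is_path P E u w xs \<Longrightarrow> c * dist u w \<le> path_length xs"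
  shows "ennreal c \<le> spanning_ratio P E"
  unfolding spanning_ratio_def
proof (rule Inf_greatest)
  fix t
  assume "t \<in> {t. \<forall>u\<in>P. \<forall>w\<in>P. graph_dist P E u w \<le> t * ennreal (dist u w)}"
  then have t: "graph_dist P E u w \<le> t * ennreal (dist u w)"
    using assms(1,2) by blast
  show "ennreal c \<le> t"
  proof (cases "c \<ge> 0")
    case True
    have "ennreal c * ennreal (dist u w) = ennreal (c * dist u w)"
      using True by (simp add: ennreal_mult)
    also have "\<dots> \<le> graph_dist P E u w"
      unfolding graph_dist_def by (rule INF_greatest) (auto intro: ennreal_leI assms(4))
    finally have "ennreal c * ennreal (dist u w) \<le> t * ennreal (dist u w)"
      \<comment> \<open>Cancellation in \<open>ennreal\<close> requires a factor that is neither 0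
        nor infinite.\<close>
      using t by (rule order_trans)
    moreover have "0 < ennreal (dist u w)" "ennreal (dist u w) < top"
      using assms(3) by simp_all
    ultimately show ?thesis
      by (metis ennreal_mult_le_mult_iff mult.commute order_less_irrefl)
  qed (simp add: ennreal_neg)
qed

section \<open>Sign conditions for small perturbations\<close>

text \<open>For small positive arguments the first nonzero coefficient decides the sign.\<close>

lemma eventually_quadratic_pos:
  fixes a b c :: real
  assumes "0 < a \<or> a = 0 \<and> (0 < b \<or> b = 0 \<and> 0 < c)"
  shows "\<forall>\<^sub>F t in at_right 0. 0 < a + t * b + t\<^sup>2 * c"
proof -
  have pos: "\<forall>\<^sub>F t in at_right 0. (0::real) < t"
    by (rule eventually_at_right_less)
  have lin: "\<forall>\<^sub>F t in at_right 0. 0 < b' + t * c'" if "0 < b'" for b' c' :: real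
  proof (rule order_tendstoD)
    show "((\<lambda>t. b' + t * c') \<longlongrightarrow> b' + 0 * c') (at_right 0)"
      by (intro tendsto_intros)
  qed (use that in simp)
  consider "0 < a" | "a = 0" "0 < b" | "a = 0" "b = 0" "0 < c"
    using assms by blast
  then show ?thesis
  proof cases
    case 1
    have "((\<lambda>t. a + t * b + t\<^sup>2 * c) \<longlongrightarrow> a + 0 * b + 0\<^sup>2 * c) (at_right 0)"
      by (intro tendsto_intros)
    with 1 show ?thesis
      by (intro order_tendstoD) simp_all
  next
    case 2
    show ?thesis
      using pos lin[OF 2(2), of c]
      by eventually_elim (use 2 in \<open>simp add: power2_eq_square mult.assoc flip: distrib_left\<close>)
  next
    case 3
    show ?thesis
      using pos by eventually_elim (use 3 in simp)
  qed
qed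

text \<open>Since \<open>c\<close> is nonzero, a first nonzero coefficient exists; its sign tells
  whether the polynomial or its negative is eventually positive.\<close>

lemma eventually_quadratic_nonzero:
  fixes a b c :: real
  assumes "c \<noteq> 0"
  shows "\<forall>\<^sub>F t in at_right 0. a + t * b + t\<^sup>2 * c \<noteq> 0"
proof -
  consider "0 < a \<or> a = 0 \<and> (0 < b \<or> b = 0 \<and> 0 < c)"
    | "0 < - a \<or> - a = 0 \<and> (0 < - b \<or> - b = 0 \<and> 0 < - c)"
    using assms by linarith
  then show ?thesis
  proof cases
    case 1
    from eventually_quadratic_pos[OF this] show ?thesis
      by (rule eventually_mono) simp
  next
    case 2
    from eventually_quadratic_pos[OF this] show ?thesis
      by (rule eventually_mono) (simp add: algebra_simps)
  qed
qed

section \<open>Exact arithmetic in Z[sqrt 5]\<close>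

type_synonym zroot5 = "int \<times> int"

definition zval :: "zroot5 \<Rightarrow> real" where
  "zval z = of_int (fst z) + of_int (snd z) * sqrt 5"

fun zadd :: "zroot5 \<Rightarrow> zroot5 \<Rightarrow> zroot5" where
  "zadd (a, b) (c, d) = (a + c, b + d)"

fun zdiff :: "zroot5 \<Rightarrow> zroot5 \<Rightarrow> zroot5" where
  "zdiff (a, b) (c, d) = (a - c, b - d)"

fun zmul :: "zroot5 \<Rightarrow> zroot5 \<Rightarrow> zroot5" where
  "zmul (a, b) (c, d) = (a * c + 5 * (b * d), a * d + b * c)"

text \<open>When the signs of \<open>a\<close> and \<open>b\<close> differ, comparing
  \<open>a * a\<close> with \<open>5 * (b * b)\<close> decides which term dominates, so evaluation
  stays within the integers.\<close>

fun zpos :: "zroot5 \<Rightarrow> bool" where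
  "zpos (a, b) \<longleftrightarrow> (if 0 < a then 0 \<le> b \<or> 5 * (b * b) < a * a else 0 < b \<and> a * a < 5 * (b * b))"

type_synonym zpoint = "zroot5 \<times> zroot5"

definition pdiff :: "zpoint \<Rightarrow> zpoint \<Rightarrow> zpoint" where
  "pdiff p q = (zdiff (fst p) (fst q), zdiff (snd p) (snd q))"

definition zdot :: "zpoint \<Rightarrow> zpoint \<Rightarrow> zroot5" where
  "zdot p q = zadd (zmul (fst p) (fst q)) (zmul (snd p) (snd q))"

lemma zval_zadd: "zval (zadd z z') = zval z + zval z'"
  by (cases z; cases z') (simp add: zval_def algebra_simps)

lemma zval_zdiff: "zval (zdiff z z') = zval z - zval z'"
  by (cases z; cases z') (simp add: zval_def algebra_simps)

lemma zval_zmul: "zval (zmul z z') = zval z * zval z'"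
  by (cases z; cases z') (simp add: zval_def algebra_simps)

lemma zval_zdot: "zval (zdot k p) = zval (fst k) * zval (fst p) + zval (snd k) * zval (snd p)"
  by (simp add: zdot_def zval_zadd zval_zmul)

lemma zval_pdiff:
  "zval (fst (pdiff p q)) = zval (fst p) - zval (fst q)"
  "zval (snd (pdiff p q)) = zval (snd p) - zval (snd q)"
  by (simp_all add: pdiff_def zval_zdiff)

lemma zval_pos:
  assumes "zpos z"
  shows "0 < zval z"
proof -
  obtain a b where z: "z = (a, b)" by fastforce
  have sq: "(\<bar>of_int x\<bar> * sqrt 5)\<^sup>2 = (of_int (5 * (x * x)) :: real)" for x :: int
    unfolding power_mult_distrib by (simp add: power2_eq_square)
  have sq': "\<bar>of_int x :: real\<bar>\<^sup>2 = of_int (x * x)" for x :: int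
    by (simp add: power2_eq_square)
  have lt: "\<bar>of_int x\<bar> * sqrt 5 < \<bar>of_int y\<bar>" if "5 * (x * x) < y * y" for x y :: int
  proof (rule power_less_imp_less_base)
    show "(\<bar>of_int x\<bar> * sqrt 5)\<^sup>2 < \<bar>of_int y :: real\<bar>\<^sup>2"
      using that unfolding sq sq' of_int_less_iff .
  qed simp
  have gt: "\<bar>of_int y\<bar> < \<bar>of_int x\<bar> * sqrt 5" if "y * y < 5 * (x * x)" for x y :: int
  proof (rule power_less_imp_less_base)
    show "\<bar>of_int y :: real\<bar>\<^sup>2 < (\<bar>of_int x\<bar> * sqrt 5)\<^sup>2"
      using that unfolding sq sq' of_int_less_iff .
  qed simp
  consider "0 < a" "0 \<le> b" | "0 < a" "5 * (b * b) < a * a" | "0 < b" "a * a < 5 * (b * b)"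
    using assms by (auto simp: z split: if_splits)
  then show ?thesis
  proof cases
    case 1
    then show ?thesis by (simp add: z zval_def add_pos_nonneg)
  next
    case 2
    have "- (of_int b * sqrt 5) \<le> \<bar>of_int b\<bar> * sqrt 5"
      by (simp add: abs_if)
    with lt[OF 2(2)] 2(1) show ?thesis by (simp add: z zval_def)
  next
    case 3
    with gt[OF 3(2)] show ?thesis by (simp add: z zval_def)
  qed
qed

text \<open>The first coordinates of \<open>limit\<close> and \<open>shift\<close> are in units of \<open>sin (2 * pi / 5)\<close>, which
  keeps the inner products with the bisector directions in \<open>\<rat>(\<surd>5)\<close>.\<close>

datatype vertex = Vertex (index: int) (limit: zpoint) (shift: zpoint) (potential: zroot5)

text \<open>The division cancels the unit of the first coordinate in \<open>place\<close>.\<close>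

definition functional :: "zpoint \<Rightarrow> complex \<Rightarrow> real" where
  "functional k p = zval (fst k) / sin cone_angle * Re p + zval (snd k) * Im p"

text \<open>The second-order terms share one direction, so the difference of two vertices has a
  multiple of \<open>1 + \<i>\<close> there, nonzero when the indices differ.\<close>

definition place :: "real \<Rightarrow> vertex \<Rightarrow> complex" where
  "place \<delta> v =
    Complex (sin cone_angle * (zval (fst (limit v)) + \<delta> * zval (fst (shift v))))
      (zval (snd (limit v)) + \<delta> * zval (snd (shift v))) + (\<delta>\<^sup>2 * of_int (index v)) *\<^sub>R (1 + \<i>)"

text \<open>Eight times the bisector directions, as coefficients of the scaled first and the second coordinate.\<close>

definition dir8 :: "nat \<Rightarrow> zpoint" where
  "dir8 c = [((0, 0), (8, 0)), ((5, 1), (-2, 2)), ((0, 2), (-2, -2)), ((0, -2), (-2, -2)),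
     ((-5, -1), (-2, 2))] ! c"

text \<open>Positivity of the linear functional \<open>k\<close> at \<open>w - v\<close> for all small \<open>\<delta>\<close>.\<close>

definition ahead :: "zpoint \<Rightarrow> vertex \<Rightarrow> vertex \<Rightarrow> bool" where
  "ahead k v w \<longleftrightarrow>
    (let z = zdot k (pdiff (limit w) (limit v)) in
      zpos z \<or> (z = (0, 0) \<and> zpos (zdot k (pdiff (shift w) (shift v)))))"

text \<open>Strict form of the inner product criterion for cones; the explicit list of indices makes
  it executable.\<close>

definition in_cone :: "nat \<Rightarrow> vertex \<Rightarrow> vertex \<Rightarrow> bool" where
  "in_cone c v w \<longleftrightarrow>
    (\<forall>k\<in>set [0, 1, 2, 3, 4]. k \<noteq> c \<longrightarrow> ahead (pdiff (dir8 c) (dir8 k)) v w)"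

definition non_edge :: "vertex list \<Rightarrow> vertex \<Rightarrow> vertex \<Rightarrow> bool" where
  "non_edge vs v w \<longleftrightarrow>
    (\<exists>c\<in>set [0, 1, 2, 3, 4]. in_cone c v w \<and> (\<exists>z\<in>set vs. ahead (dir8 c) z w \<and> in_cone c v z))"

text \<open>Here \<open>8 * (sin (2 * pi / 5))\<^sup>2 = 5 + sqrt 5\<close> is the weight of the scaled first
  coordinate in eight times the squared distance.\<close>

definition lipschitz :: "vertex \<Rightarrow> vertex \<Rightarrow> bool" where
  "lipschitz v w \<longleftrightarrow>
    (let (x, y) = pdiff (limit w) (limit v); f = zdiff (potential w) (potential v);
       z = zdot ((5, 1), (8, 0)) (zmul x x, zdiff (zmul y y) (zmul f f))
     in zpos z \<or> z = (0, 0))"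

section \<open>Soundness of the exact tests\<close>

text \<open>Multiplied by \<open>sin cone_angle\<close>, the sines of the bisector angles fall into
  Q(sqrt 5). Cones 3 and 4 mirror cones 2 and 1.\<close>

lemma functional_dir8:
  assumes "c < 5"
  shows "functional (dir8 c) p = 8 * (p \<bullet> bisector_dir c)"
proof -
  let ?s = "sin cone_angle"
  have s: "(5 + sqrt 5) / ?s = 8 * ?s"
    using sin_cone_angle_sq by (simp add: field_simps power2_eq_square)
  have c2: "cos (2 * cone_angle) = - (1 + sqrt 5) / 4"
    unfolding cos_double_cos cos_cone_angle by (simp add: field_simps power2_eq_square)
  have s2: "8 * sin (2 * cone_angle) = 2 * sqrt 5 / ?s"
  proof -
    have "8 * sin (2 * cone_angle) * ?s = 16 * ?s\<^sup>2 * cos cone_angle"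
      by (simp add: sin_double power2_eq_square)
    also have "\<dots> = 2 * sqrt 5"
      unfolding sin_cone_angle_sq cos_cone_angle by (simp add: field_simps)
    finally have "8 * sin (2 * cone_angle) * ?s = 2 * sqrt 5" .
    then show ?thesis by (simp add: field_simps)
  qed
  have "3 * cone_angle = 2 * pi - 2 * cone_angle" "4 * cone_angle = 2 * pi - cone_angle"
    by (simp_all add: cone_angle_def)
  then have 34: "cos (3 * cone_angle) = cos (2 * cone_angle)" "sin (3 * cone_angle) = - sin (2 * cone_angle)"
     "cos (4 * cone_angle) = cos cone_angle" "sin (4 * cone_angle) = - sin cone_angle"
    by (simp_all only: cos_2pi_minus sin_2pi_minus)
  have dir: "bisector_dir c = Complex (sin (real c * cone_angle)) (cos (real c * cone_angle))"
    by (simp add: bisector_dir_def complex_eq_iff)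
  consider "c = 0" | "c = 1" | "c = 2" | "c = 3" | "c = 4"
    using assms by linarith
  then have "zval (fst (dir8 c)) / ?s = 8 * sin (real c * cone_angle) \<and>
    zval (snd (dir8 c)) = 8 * cos (real c * cone_angle)"
  proof cases
    case 1 then show ?thesis by (simp add: dir8_def zval_def)
  next
    case 2 then show ?thesis using s by (simp add: dir8_def zval_def cos_cone_angle)
  next
    case 3 then show ?thesis using s2 by (simp add: dir8_def zval_def c2)
  next
    case 4 then show ?thesis using s2 by (simp add: dir8_def zval_def 34 c2)
  next
    case 5 then show ?thesis
      using s minus_divide_left[of "5 + sqrt 5" ?s] by (simp add: dir8_def zval_def 34 cos_cone_angle)
  qed
  then show ?thesis
    by (simp add: functional_def dir inner_complex_def algebra_simps)
qed

lemma functional_pdiff: "functional (pdiff k k') p = functional k p - functional k' p"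
  by (simp add: functional_def zval_pdiff diff_divide_distrib algebra_simps)

lemma functional_place_diff:
  "functional k (place \<delta> w - place \<delta> v) =
    zval (zdot k (pdiff (limit w) (limit v))) + \<delta> * zval (zdot k (pdiff (shift w) (shift v))) +
    \<delta>\<^sup>2 * (of_int (index w - index v) * functional k (1 + \<i>))"
  by (simp add: functional_def place_def zval_zdot zval_pdiff field_simps)

text \<open>The test settles the sign at order 0 or 1 in \<delta>, so the term of order 2 cannot
  change it.\<close>

lemma ahead_eventually:
  assumes "ahead k v w"
  shows "\<forall>\<^sub>F \<delta> in at_right 0. 0 < functional k (place \<delta> w - place \<delta> v)"
  unfolding functional_place_diff
proof (rule eventually_quadratic_pos)
  let ?z = "zdot k (pdiff (limit w) (limit v))" and ?z' = "zdot k (pdiff (shift w) (shift v))"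
  have "zval (0, 0) = 0"
    by (simp add: zval_def)
  moreover have "zpos ?z \<or> ?z = (0, 0) \<and> zpos ?z'"
    using assms by (simp add: ahead_def Let_def)
  ultimately show "0 < zval ?z \<or> zval ?z = 0 \<and> (0 < zval ?z' \<or> zval ?z' = 0 \<and>
      0 < of_int (index w - index v) * functional k (1 + \<i>))"
    using zval_pos by metis
qed

lemma in_cone_eventually:
  assumes "in_cone c v w" "c < 5"
  shows "\<forall>\<^sub>F \<delta> in at_right 0. \<forall>k\<in>{..<5} - {c}.
    (place \<delta> w - place \<delta> v) \<bullet> bisector_dir k < (place \<delta> w - place \<delta> v) \<bullet> bisector_dir c"
proof (intro eventually_ball_finite ballI)
  fix k :: nat
  assume k: "k \<in> {..<5} - {c}"
  then have "ahead (pdiff (dir8 c) (dir8 k)) v w"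
    using assms(1) by (auto simp: in_cone_def eval_nat_numeral less_Suc_eq)
  from ahead_eventually[OF this]
  show "\<forall>\<^sub>F \<delta> in at_right 0.
    (place \<delta> w - place \<delta> v) \<bullet> bisector_dir k < (place \<delta> w - place \<delta> v) \<bullet> bisector_dir c"
    by (rule eventually_mono) (use assms(2) k in \<open>simp add: functional_pdiff functional_dir8\<close>)
qed simp

lemma non_edge_eventually:
  assumes "non_edge vs v w"
  shows "\<forall>\<^sub>F \<delta> in at_right 0. \<forall>i<5. \<not> closest_in_cone (place \<delta> ` set vs) i (place \<delta> v) (place \<delta> w)"
proof -
  obtain c z where c: "c \<in> set [0, 1, 2, 3, 4]" and w: "in_cone c v w" and z: "z \<in> set vs" "in_cone c v z"
    and zw: "ahead (dir8 c) z w"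
    using assms unfolding non_edge_def by blast
  have "c < 5"
    using c by auto
  show ?thesis
    using in_cone_eventually[OF w \<open>c < 5\<close>] in_cone_eventually[OF z(2) \<open>c < 5\<close>] ahead_eventually[OF zw]
  proof eventually_elim
    case (elim \<delta>)
    have "(place \<delta> z - place \<delta> v) \<bullet> bisector_dir c < (place \<delta> w - place \<delta> v) \<bullet> bisector_dir c"
      using elim(3) \<open>c < 5\<close> by (simp add: functional_dir8 inner_diff_left)
    with elim(1,2) z(1) show ?case
      by (intro allI impI not_closest_in_cone[OF \<open>c < 5\<close>]) auto
  qed
qed

text \<open>The tested number is eight times the squared distance of the limit points minus eight
  times the squared potential difference.\<close>

lemma lipschitz_le_dist:
  assumes "lipschitz v w"
  shows "\<bar>zval (potential w) - zval (potential v)\<bar> \<le> dist (place 0 v) (place 0 w)"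
proof -
  define x where "x = zval (fst (limit w)) - zval (fst (limit v))"
  define y where "y = zval (snd (limit w)) - zval (snd (limit v))"
  define f where "f = zval (potential w) - zval (potential v)"
  obtain X Y where XY: "pdiff (limit w) (limit v) = (X, Y)"
    by (cases "pdiff (limit w) (limit v)")
  let ?F = "zdiff (potential w) (potential v)"
  define z where "z = zdot ((5, 1), (8, 0)) (zmul X X, zdiff (zmul Y Y) (zmul ?F ?F))"
  have "zpos z \<or> z = (0, 0)"
    using assms by (simp add: lipschitz_def XY z_def Let_def)
  then have "0 \<le> zval z"
    using zval_pos[of z] by (auto simp: zval_def)
  moreover have "zval X = x" "zval Y = y" "zval ?F = f"
    using zval_pdiff[of "limit w" "limit v"] by (simp_all add: XY x_def y_def f_def zval_zdiff)
  ultimately have "0 \<le> (5 + sqrt 5) * (x * x) + 8 * (y * y - f * f)"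
    unfolding z_def by (simp only: zval_zdot zval_zdiff zval_zmul fst_conv snd_conv) (simp add: zval_def)
  then have "f\<^sup>2 \<le> (sin cone_angle)\<^sup>2 * x\<^sup>2 + y\<^sup>2"
    unfolding sin_cone_angle_sq by (simp add: power2_eq_square field_simps)
  also have "\<dots> = (dist (place 0 v) (place 0 w))\<^sup>2"
    unfolding dist_norm cmod_power2
    by (simp add: place_def x_def y_def power2_eq_square algebra_simps)
  finally have "\<bar>f\<bar>\<^sup>2 \<le> (dist (place 0 v) (place 0 w))\<^sup>2"
    by simp
  then show ?thesis
    unfolding f_def by (rule power2_le_imp_le) simp
qed

lemma tendsto_dist_place:
  "((\<lambda>\<delta>. dist (place \<delta> v) (place \<delta> w)) \<longlongrightarrow> dist (place 0 v) (place 0 w)) (at_right 0)"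
proof -
  have "isCont (\<lambda>\<delta>. dist (place \<delta> v) (place \<delta> w)) 0"
    unfolding place_def Complex_eq by (intro continuous_intros)
  then show ?thesis
    by (simp add: isCont_def filterlim_at_split)
qed

section \<open>The configuration\<close>

definition config :: "vertex list" where
  "config = [
    Vertex 0 ((0, 0), (0, 0)) ((0, 0), (0, 0)) (0, 0),
    Vertex 1 ((-100, 100), (50, 50)) ((0, 0), (3, 0)) (-1700, 1100),
    Vertex 2 ((-100, 100), (250, -150)) ((-1, 0), (1, 0)) (-1500, 900),
    Vertex 3 ((400, -200), (-250, 50)) ((1, 0), (2, 0)) (-1000, 600),
    Vertex 4 ((-600, 200), (0, 0)) ((4, 0), (-1, 0)) (-500, 300),
    Vertex 5 ((100, -100), (150, -50)) ((4, 0), (-3, 0)) (-100, 100),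
    Vertex 6 ((-137, 0), (-147, 0)) ((0, 0), (0, 0)) (256, 0),
    Vertex 7 ((1, 0), (-170, 0)) ((0, 0), (0, 0)) (169, 0),
    Vertex 8 ((44, 0), (372, 0)) ((0, 0), (0, 0)) (443, 0),
    Vertex 9 ((-163, 0), (-58, 0)) ((0, 0), (0, 0)) (164, 0),
    Vertex 10 ((170, 0), (-222, 0)) ((0, 0), (0, 0)) (336, 0),
    Vertex 11 ((-64, 0), (-188, 0)) ((0, 0), (0, 0)) (233, 0),
    Vertex 12 ((-5, 0), (-231, 0)) ((0, 0), (0, 0)) (230, 0),
    Vertex 13 ((-180, 0), (325, 0)) ((0, 0), (0, 0)) (367, 0),
    Vertex 14 ((16, 0), (-216, 0)) ((0, 0), (0, 0)) (217, 0),
    Vertex 15 ((-63, 0), (-214, 0)) ((0, 0), (0, 0)) (259, 0),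
    Vertex 16 ((118, 0), (-250, 0)) ((0, 0), (0, 0)) (354, 0),
    Vertex 17 ((243, 0), (-126, 0)) ((0, 0), (0, 0)) (454, 0),
    Vertex 18 ((-44, 0), (368, 0)) ((0, 0), (0, 0)) (503, 0),
    Vertex 19 ((206, 0), (313, 0)) ((0, 0), (0, 0)) (607, 0),
    Vertex 20 ((-70, 0), (-210, 0)) ((0, 0), (0, 0)) (255, 0),
    Vertex 21 ((-47, 0), (-203, 0)) ((0, 0), (0, 0)) (277, 0),
    Vertex 22 ((-100, 0), (-139, 0)) ((0, 0), (0, 0)) (292, 0),
    Vertex 23 ((-108, 0), (-157, 0)) ((0, 0), (0, 0)) (283, 0),
    Vertex 24 ((21, 0), (-265, 0)) ((0, 0), (0, 0)) (261, 0),
    Vertex 25 ((-121, 0), (161, 0)) ((0, 0), (0, 0)) (194, 0)]"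

text \<open>The finite check behind the theorem. It runs over ordered pairs because
  \<open>non_edge\<close> concerns only the choices of its first vertex; for equal vertices
  \<open>lipschitz\<close> holds with value 0.\<close>

lemma config_certified: "\<forall>v\<in>set config. \<forall>w\<in>set config. lipschitz v w \<or> non_edge config v w"
  by code_simp

text \<open>Gives every pair of distinct vertices a nonzero term of order 2 in \<delta>.\<close>

lemma distinct_index: "distinct (map index config)"
  by (simp add: config_def)

lemma index_neq:
  assumes "v \<in> set config" "w \<in> set config" "v \<noteq> w"
  shows "index v \<noteq> index w"
  using distinct_index assms by (auto simp: distinct_map dest: inj_onD)

text \<open>Each inner product is a polynomial in \<delta> whose quadratic coefficient is the index
  difference times the inner product with \<open>1 + \<i>\<close>, hence nonzero. Only finitely many
  such conditions arise.\<close>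

lemma generic_eventually:
  "\<forall>\<^sub>F \<delta> in at_right 0. \<forall>k\<in>{0..<5::int}. \<forall>v\<in>set config. \<forall>w\<in>set config. v \<noteq> w \<longrightarrow>
    (place \<delta> w - place \<delta> v) \<bullet> boundary_dir k \<noteq> 0 \<and>
    (place \<delta> w - place \<delta> v) \<bullet> (\<i> * boundary_dir k) \<noteq> 0"
proof (intro eventually_ball_finite ballI finite_set)
  fix k v w
  assume *: "v \<in> set config" "w \<in> set config"
  have inner: "\<forall>\<^sub>F \<delta> in at_right 0. (place \<delta> w - place \<delta> v) \<bullet> e \<noteq> 0" if "v \<noteq> w" "(1 + \<i>) \<bullet> e \<noteq> 0" for e
  proof -
    obtain p q where pq: "place \<delta> w - place \<delta> v = p + \<delta> *\<^sub>R q + \<delta>\<^sup>2 *\<^sub>R of_int (index w - index v) *\<^sub>R (1 + \<i>)" for \<delta>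
    proof
      fix \<delta>
      show "place \<delta> w - place \<delta> v =
        Complex (sin cone_angle * (zval (fst (limit w)) - zval (fst (limit v))))
          (zval (snd (limit w)) - zval (snd (limit v))) +
        \<delta> *\<^sub>R Complex (sin cone_angle * (zval (fst (shift w)) - zval (fst (shift v))))
          (zval (snd (shift w)) - zval (snd (shift v))) +
        \<delta>\<^sup>2 *\<^sub>R of_int (index w - index v) *\<^sub>R (1 + \<i>)"
        by (simp add: place_def complex_eq_iff algebra_simps)
    qed
    have "of_int (index w - index v) * ((1 + \<i>) \<bullet> e) \<noteq> 0"
      using index_neq[OF *] that by simp
    from eventually_quadratic_nonzero[OF this, of "p \<bullet> e" "q \<bullet> e"] show ?thesis
      unfolding pq by (rule eventually_mono) (simp add: inner_add_left)
  qed
  show "\<forall>\<^sub>F \<delta> in at_right 0. v \<noteq> w \<longrightarrow> (place \<delta> w - place \<delta> v) \<bullet> boundary_dir k \<noteq> 0 \<and>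
    (place \<delta> w - place \<delta> v) \<bullet> (\<i> * boundary_dir k) \<noteq> 0"
  proof (cases "v = w")
    case False
    from inner[OF False inner_boundary_dir_diagonal(1)] inner[OF False inner_boundary_dir_diagonal(2)]
    show ?thesis by eventually_elim blast
  qed simp
qed simp

section \<open>From the configuration to the bound\<close>

text \<open>\<open>lipschitz\<close> compares limit distances and permits equality, so nearby
  positions need the slack \<eta>.\<close>

lemma edges_eventually:
  assumes "\<eta> > 0"
  shows "\<forall>\<^sub>F \<delta> in at_right 0. \<forall>v\<in>set config. \<forall>w\<in>set config.
    (\<exists>i<5. closest_in_cone (place \<delta> ` set config) i (place \<delta> v) (place \<delta> w)) \<longrightarrow>
      \<bar>zval (potential w) - zval (potential v)\<bar> - \<eta> \<le> dist (place \<delta> v) (place \<delta> w)"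
proof (intro eventually_ball_finite ballI finite_set)
  fix v w
  assume "v \<in> set config" "w \<in> set config"
  then consider "lipschitz v w" | "non_edge config v w"
    using config_certified by blast
  then show "\<forall>\<^sub>F \<delta> in at_right 0.
    (\<exists>i<5. closest_in_cone (place \<delta> ` set config) i (place \<delta> v) (place \<delta> w)) \<longrightarrow>
      \<bar>zval (potential w) - zval (potential v)\<bar> - \<eta> \<le> dist (place \<delta> v) (place \<delta> w)"
  proof cases
    case 1
    then have "\<bar>zval (potential w) - zval (potential v)\<bar> - \<eta> < dist (place 0 v) (place 0 w)"
      using lipschitz_le_dist[of v w] assms by simp
    from order_tendstoD(1)[OF tendsto_dist_place this] show ?thesis
      by (rule eventually_mono) simp
  next
    case 2
    from non_edge_eventually[OF this] show ?thesis
      by (rule eventually_mono) auto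
  qed
qed

lemma theta5_lower_bound:
  fixes \<epsilon> :: real
  assumes "\<epsilon> > 0"
  shows "\<exists>P u w. finite P \<and> general_position P \<and> u \<in> P \<and> w \<in> P \<and> u \<noteq> w \<and>
    (\<forall>xs. is_path P (theta5_edges P) u w xs \<longrightarrow>
      path_length xs > (1 / 2 * (11 * sqrt 5 - 17) - \<epsilon>) * dist u w)"
proof -
  let ?c = "1 / 2 * (11 * sqrt 5 - 17) :: real"
  define a where "a = config ! 1"
  define b where "b = config ! 0"
  have ab: "a \<in> set config" "b \<in> set config"
    unfolding a_def b_def by (rule nth_mem, simp add: config_def)+
  have "a \<noteq> b"
    by (simp add: a_def b_def config_def)
  have pot: "zval (potential a) - zval (potential b) = 200 * ?c"
    by (simp add: a_def b_def config_def zval_def)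
  have "dist (place 0 a) (place 0 b) = 200"
  proof -
    have "(dist (place 0 a) (place 0 b))\<^sup>2 =
      (sin cone_angle)\<^sup>2 * (100 * sqrt 5 - 100)\<^sup>2 + (50 + 50 * sqrt 5)\<^sup>2"
      by (simp add: dist_norm cmod_power2 place_def a_def b_def config_def zval_def power_mult_distrib)
    also have "\<dots> = 200\<^sup>2"
    proof -
      have *: "sqrt 5 * (sqrt 5 * x) = 5 * x" for x
        by (simp flip: mult.assoc)
      show ?thesis
        unfolding sin_cone_angle_sq by (simp add: power2_eq_square field_simps *)
    qed
    finally show ?thesis
      by (rule power2_eq_imp_eq) simp_all
  qed
  \<comment> \<open>The available slack is \<open>200 * \<epsilon>\<close>. At most 25 edges lose
    \<open>125 * \<epsilon>\<close> in total, and the excess \<eta> of the end distance over 200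
    costs less than \<open>75 * \<epsilon>\<close>, as \<open>?c - \<epsilon> < 15\<close>.\<close>
  define \<eta> where "\<eta> = \<epsilon> * 5"
  have "\<eta> > 0"
    using assms by (simp add: \<eta>_def)
  have "\<forall>\<^sub>F \<delta> in at_right 0. dist (place \<delta> a) (place \<delta> b) < 200 + \<eta>"
    using \<open>\<eta> > 0\<close> \<open>dist (place 0 a) (place 0 b) = 200\<close>
    by (intro order_tendstoD(2)[OF tendsto_dist_place]) simp
  from eventually_happens'[OF trivial_limit_at_right_real
      eventually_conj[OF this eventually_conj[OF generic_eventually edges_eventually[OF \<open>\<eta> > 0\<close>]]]]
  obtain \<delta> where dist: "dist (place \<delta> a) (place \<delta> b) < 200 + \<eta>"
    and generic: "\<forall>k\<in>{0..<5}. \<forall>v\<in>set config. \<forall>w\<in>set config. v \<noteq> w \<longrightarrow>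
      (place \<delta> w - place \<delta> v) \<bullet> boundary_dir k \<noteq> 0 \<and>
      (place \<delta> w - place \<delta> v) \<bullet> (\<i> * boundary_dir k) \<noteq> 0"
    and edges: "\<forall>v\<in>set config. \<forall>w\<in>set config.
      (\<exists>i<5. closest_in_cone (place \<delta> ` set config) i (place \<delta> v) (place \<delta> w)) \<longrightarrow>
      \<bar>zval (potential w) - zval (potential v)\<bar> - \<eta> \<le> dist (place \<delta> v) (place \<delta> w)"
    by (elim exE conjE)
  define P where "P = place \<delta> ` set config"
  \<comment> \<open>Carries the potential from vertices to points; this is meaningful because
    \<open>place \<delta>\<close> is injective on the configuration, shown next.\<close>
  define g where "g = (\<lambda>p. zval (potential (the_inv_into (set config) (place \<delta>) p)))"
  have inj: "inj_on (place \<delta>) (set config)"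
  proof (rule inj_onI, rule ccontr)
    fix v w
    assume "v \<in> set config" "w \<in> set config" "place \<delta> v = place \<delta> w" "v \<noteq> w"
    with bspec[OF generic, of 0] show False by fastforce
  qed
  then have g: "g (place \<delta> v) = zval (potential v)" if "v \<in> set config" for v
    using that by (simp add: g_def the_inv_into_f_f)
  have "general_position P"
    using generic by (intro general_positionI) (force simp: P_def)
  have edge: "g x - g y - \<eta> \<le> dist x y" if "x \<in> P" "y \<in> P" "{x, y} \<in> theta5_edges P" for x y
  proof -
    obtain v w where vw: "v \<in> set config" "w \<in> set config" "x = place \<delta> v" "y = place \<delta> w"
      using \<open>x \<in> P\<close> \<open>y \<in> P\<close> by (auto simp: P_def)
    \<comment> \<open>Edges are undirected, so either end may have chosen the other.\<close>
    obtain i where "i < 5" and closest: "closest_in_cone P i x y \<or> closest_in_cone P i y x"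
      using \<open>{x, y} \<in> theta5_edges P\<close> by (auto simp: theta5_edges_def doubleton_eq_iff)
    from closest have "\<bar>g x - g y\<bar> - \<eta> \<le> dist x y"
    proof
      assume "closest_in_cone P i x y"
      then have "\<bar>zval (potential w) - zval (potential v)\<bar> - \<eta> \<le> dist (place \<delta> v) (place \<delta> w)"
        using edges vw \<open>i < 5\<close> by (auto simp: P_def)
      then show ?thesis
        using vw by (simp add: g abs_minus_commute)
    next
      assume "closest_in_cone P i y x"
      then have "\<bar>zval (potential v) - zval (potential w)\<bar> - \<eta> \<le> dist (place \<delta> w) (place \<delta> v)"
        using edges vw \<open>i < 5\<close> by (auto simp: P_def)
      then show ?thesis
        using vw by (simp add: g dist_commute)
    qed
    then show ?thesis by linarith
  qed
  have neq: "place \<delta> a \<noteq> place \<delta> b"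
    using inj ab \<open>a \<noteq> b\<close> by (auto dest: inj_onD)
  have card: "card P \<le> 26"
    using card_image_le[of "set config" "place \<delta>"] card_length[of config] by (simp add: P_def config_def)
  have "path_length xs > (?c - \<epsilon>) * dist (place \<delta> a) (place \<delta> b)"
    if xs: "is_path P (theta5_edges P) (place \<delta> a) (place \<delta> b) xs" for xs
  proof -
    \<comment> \<open>Paths have distinct vertices, which bounds the accumulated loss.\<close>
    have "length xs \<le> 26"
      using xs card distinct_card[of xs] card_mono[of P "set xs"] by (simp add: is_path_def P_def)
    then have "\<eta> * (real (length xs) - 1) \<le> \<eta> * 25"
      using \<open>\<eta> > 0\<close> by (intro mult_left_mono) auto
    moreover have "g (hd xs) - g (last xs) - \<eta> * (real (length xs) - 1) \<le> path_length xs"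
      by (rule path_length_ge[of _ "theta5_edges P" P]) (use xs edge in \<open>auto simp: is_path_def\<close>)
    moreover have "g (hd xs) - g (last xs) = 200 * ?c"
      using xs ab by (simp add: is_path_def g pot)
    ultimately have length: "200 * ?c - 25 * \<eta> \<le> path_length xs"
      by linarith
    show ?thesis
    proof (cases "\<epsilon> \<le> ?c")
      case True
      have "?c - \<epsilon> < 15"
        using assms real_sqrt_less_mono[of 5 9] by (simp add: field_simps)
      then have "\<epsilon> * (?c - \<epsilon>) < \<epsilon> * 15"
        using assms by (rule mult_strict_left_mono)
      moreover have "(?c - \<epsilon>) * dist (place \<delta> a) (place \<delta> b) \<le> (?c - \<epsilon>) * (200 + \<eta>)"
        using True dist by (intro mult_left_mono) auto
      moreover have "(?c - \<epsilon>) * (200 + \<eta>) = 200 * ?c - 200 * \<epsilon> + 5 * (\<epsilon> * (?c - \<epsilon>))"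
        by (simp add: \<eta>_def algebra_simps)
      ultimately show ?thesis
        using length unfolding \<eta>_def by linarith
    \<comment> \<open>For \<epsilon> beyond \<open>?c\<close> the claimed bound is negative.\<close>
    next
      case False
      then have "(?c - \<epsilon>) * dist (place \<delta> a) (place \<delta> b) < 0"
        using neq by (intro mult_neg_pos) auto
      also have "0 \<le> path_length xs"
        unfolding path_length_def by (rule sum_list_nonneg) auto
      finally show ?thesis .
    qed
  qed
  moreover have "finite P" "place \<delta> a \<in> P" "place \<delta> b \<in> P"
    using ab by (simp_all add: P_def)
  ultimately show ?thesis
    using \<open>general_position P\<close> neq by blast
qed

text \<open>The bound on the supremum follows from the explicit form: every witness set has spanning
  ratio at least \<open>?c - \<epsilon>\<close>, and \<epsilon> is arbitrary.\<close>

theorem theorem4: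
  shows "(SUP P\<in>{P. finite P \<and> general_position P}. spanning_ratio P (theta5_edges P))
           \<ge> ennreal (1 / 2 * (11 * sqrt 5 - 17))
       \<and> (\<forall>\<epsilon>>0. \<exists>P u w. finite P \<and> general_position P \<and> u \<in> P \<and> w \<in> P \<and> u \<noteq> w \<and>
            (\<forall>xs. is_path P (theta5_edges P) u w xs \<longrightarrow>
              path_length xs > (1 / 2 * (11 * sqrt 5 - 17) - \<epsilon>) * dist u w))"
proof (intro conjI allI impI theta5_lower_bound)
  let ?c = "1 / 2 * (11 * sqrt 5 - 17) :: real"
  let ?S = "SUP P\<in>{P. finite P \<and> general_position P}. spanning_ratio P (theta5_edges P)"
  show "?S \<ge> ennreal ?c"
  proof (rule ennreal_le_epsilon)
    fix \<epsilon> :: real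
    assume "0 < \<epsilon>"
    then obtain P u w where P: "finite P" "general_position P" "u \<in> P" "w \<in> P" "u \<noteq> w"
      and "\<forall>xs. is_path P (theta5_edges P) u w xs \<longrightarrow> path_length xs > (?c - \<epsilon>) * dist u w"
      using theta5_lower_bound by blast
    then have "ennreal (?c - \<epsilon>) \<le> spanning_ratio P (theta5_edges P)"
      by (intro spanning_ratio_ge) (auto intro: less_imp_le)
    also have "\<dots> \<le> ?S"
      using P by (intro SUP_upper) simp
    finally have "ennreal (?c - \<epsilon>) + ennreal \<epsilon> \<le> ?S + ennreal \<epsilon>"
      by (intro add_right_mono)
    \<comment> \<open>\<open>ennreal\<close> sends negative numbers to 0, hence the case
      distinction; in the negative case \<open>?c\<close> is below \<epsilon>.\<close>
    moreover have "ennreal ?c \<le> ennreal (?c - \<epsilon>) + ennreal \<epsilon>"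
      using \<open>0 < \<epsilon>\<close> by (cases "0 \<le> ?c - \<epsilon>") (simp_all add: ennreal_neg ennreal_leI flip: ennreal_plus)
    ultimately show "ennreal ?c \<le> ?S + ennreal \<epsilon>"
      by (rule order_trans[rotated])
  qed
qed

end
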